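(* Let $f,g:(X,c_X)\to(Y,c_Y)$ be one-step $(J_\top,\times)$-homotopic continuous maps of closure spaces. Then $f,g:(X,\mathrm{VR}(c_X))\to(Y,\mathrm{VR}(c_Y))$ are contiguous simplicial maps, and so are $f,g:(X,\check{C}(c_X))\to(Y,\check{C}(c_Y))$ and $f,g:(X,\check{C}^T(c_X))\to(Y,\check{C}^T(c_Y))$. Conversely, let $f,g:(X,E)\to(Y,F)$ be contiguous simplicial maps. Then $f,g:(X,\mathrm{St}(E))\to(Y,\mathrm{St}(F))$ are one-step $(J_\top,\times)$-homotopic.
   Context: A (Čech) closure space $(X,c)$ is a set $X$ with a function $c:2^X\to 2^X$ such that $c(\varnothing)=\varnothing$, $A\subset c(A)$, and $c(A\cup B)=c(A)\cup c(B)$. Write $c(x)$ for $c(\{x\})$. Continuous maps satisfy $f(c_X(A))\subset c_Y(f(A))$. A set $U$ is a neighborhood of $x$ if $x\notin c(X\setminus U)$. The product closure on $X\times Y$ is $(c_X\times c_Y)(A)=\{(x,y)\mid (U\times V)\cap A\neq\varnothing$ for all neighborhoods $U$ of $x$, $V$ of $y\}$. $J_\top=\{0,1\}$ with the indiscrete closure ($c(A)=\{0,1\}$ for $A\neq\varnothing$). Continuous $f,g:X\to Y$ are one-step $(J_\top,\times)$-homotopic if there is a continuous $H:X\times J_\top\to Y$ with $H(x,0)=f(x)$, $H(x,1)=g(x)$ for all $x$. A simplicial complex $(X,E)$ is a set $X$ with a collection $E$ of nonempty finite subsets of $X$ (simplices) containing all singletons and closed under nonempty subsets; a simplicial map $f:(X,E)\to(Y,F)$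 is a map with $f(\sigma)\in F$ for $\sigma\in E$. Simplicial maps $f,g:(X,E)\to(Y,F)$ are contiguous if $f(\sigma)\cup g(\sigma)\in F$ for all $\sigma\in E$. For a closure space $(X,c)$: $\mathrm{VR}(c)$ is the set of nonempty finite $\sigma\subset X$ with $\sigma\subset c(x)$ for all $x\in\sigma$; $\check{C}(c)$ is the set of nonempty finite $\sigma\subset X$ with $\sigma\subset c(x)$ for some $x\in X$; $\check{C}^T(c)$ (reverse Čech complex) is the set of nonempty finite $\sigma\subset X$ for which there is $x\in X$ with $x\in c(y)$ for all $y\in\sigma$. For a simplicial complex $(X,E)$, $\mathrm{St}(E)$ is the closure on $X$ with $\mathrm{St}(E)(A)$ the union of all simplices in $E$ that intersect $A$. All of these are functors that are the identity on underlying set maps. *)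

theory Defs
  imports Main
begin

text \<open>Spaces are carrier sets with structure: the values of a closure operator are relevant only
  on subsets of the carrier, and the values of a map only on points of the carrier.\<close>

definition closure_space :: "'a set \<Rightarrow> ('a set \<Rightarrow> 'a set) \<Rightarrow> bool" where
  "closure_space X c \<longleftrightarrow>
     c {} = {} \<and>
     (\<forall>A\<subseteq>X. A \<subseteq> c A \<and> c A \<subseteq> X) \<and>
     (\<forall>A\<subseteq>X. \<forall>B\<subseteq>X. c (A \<union> B) = c A \<union> c B)"

definition closure_continuous ::
  "'a set \<Rightarrow> ('a set \<Rightarrow> 'a set) \<Rightarrow> 'b set \<Rightarrow> ('b set \<Rightarrow> 'b set) \<Rightarrow> ('a \<Rightarrow> 'b) \<Rightarrow> bool" where
  "closure_continuous X cX Y cY f \<longleftrightarrow>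
     closure_space X cX \<and> closure_space Y cY \<and>
     f ` X \<subseteq> Y \<and> (\<forall>A\<subseteq>X. f ` cX A \<subseteq> cY (f ` A))"

definition closure_nhd :: "'a set \<Rightarrow> ('a set \<Rightarrow> 'a set) \<Rightarrow> 'a \<Rightarrow> 'a set \<Rightarrow> bool" where
  "closure_nhd X c x U \<longleftrightarrow> U \<subseteq> X \<and> x \<notin> c (X - U)"

definition product_closure ::
  "'a set \<Rightarrow> ('a set \<Rightarrow> 'a set) \<Rightarrow> 'b set \<Rightarrow> ('b set \<Rightarrow> 'b set) \<Rightarrow> ('a \<times> 'b) set \<Rightarrow> ('a \<times> 'b) set" where
  "product_closure X cX Y cY A =
     {(x, y) \<in> X \<times> Y. \<forall>U V. closure_nhd X cX x U \<and> closure_nhd Y cY y V \<longrightarrow> (U \<times> V) \<inter> A \<noteq> {}}"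

definition Jtop :: "nat set" where
  "Jtop = {0, 1}"

definition Jtop_closure :: "nat set \<Rightarrow> nat set" where
  "Jtop_closure A = (if A = {} then {} else Jtop)"

definition one_step_homotopic ::
  "'a set \<Rightarrow> ('a set \<Rightarrow> 'a set) \<Rightarrow> 'b set \<Rightarrow> ('b set \<Rightarrow> 'b set) \<Rightarrow> ('a \<Rightarrow> 'b) \<Rightarrow> ('a \<Rightarrow> 'b) \<Rightarrow> bool" where
  "one_step_homotopic X cX Y cY f g \<longleftrightarrow>
     closure_continuous X cX Y cY f \<and> closure_continuous X cX Y cY g \<and>
     (\<exists>H. closure_continuous (X \<times> Jtop) (product_closure X cX Jtop Jtop_closure) Y cY H \<and>
          (\<forall>x\<in>X. H (x, 0) = f x \<and> H (x, 1) = g x))"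

definition simplicial_complex :: "'a set \<Rightarrow> 'a set set \<Rightarrow> bool" where
  "simplicial_complex X E \<longleftrightarrow>
     (\<forall>\<sigma>\<in>E. \<sigma> \<noteq> {} \<and> finite \<sigma> \<and> \<sigma> \<subseteq> X) \<and>
     (\<forall>x\<in>X. {x} \<in> E) \<and>
     (\<forall>\<sigma>\<in>E. \<forall>\<tau>\<subseteq>\<sigma>. \<tau> \<noteq> {} \<longrightarrow> \<tau> \<in> E)"

definition simplicial_map ::
  "'a set \<Rightarrow> 'a set set \<Rightarrow> 'b set \<Rightarrow> 'b set set \<Rightarrow> ('a \<Rightarrow> 'b) \<Rightarrow> bool" where
  "simplicial_map X E Y F f \<longleftrightarrow>
     simplicial_complex X E \<and> simplicial_complex Y F \<and>
     f ` X \<subseteq> Y \<and> (\<forall>\<sigma>\<in>E. f ` \<sigma> \<in> F)"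

definition contiguous ::
  "'a set \<Rightarrow> 'a set set \<Rightarrow> 'b set \<Rightarrow> 'b set set \<Rightarrow> ('a \<Rightarrow> 'b) \<Rightarrow> ('a \<Rightarrow> 'b) \<Rightarrow> bool" where
  "contiguous X E Y F f g \<longleftrightarrow>
     simplicial_map X E Y F f \<and> simplicial_map X E Y F g \<and>
     (\<forall>\<sigma>\<in>E. f ` \<sigma> \<union> g ` \<sigma> \<in> F)"

definition VR :: "'a set \<Rightarrow> ('a set \<Rightarrow> 'a set) \<Rightarrow> 'a set set" where
  "VR X c = {\<sigma>. \<sigma> \<noteq> {} \<and> finite \<sigma> \<and> \<sigma> \<subseteq> X \<and> (\<forall>x\<in>\<sigma>. \<sigma> \<subseteq> c {x})}"

definition Cech :: "'a set \<Rightarrow> ('a set \<Rightarrow> 'a set) \<Rightarrow> 'a set set" where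
  "Cech X c = {\<sigma>. \<sigma> \<noteq> {} \<and> finite \<sigma> \<and> \<sigma> \<subseteq> X \<and> (\<exists>x\<in>X. \<sigma> \<subseteq> c {x})}"

definition reverse_Cech :: "'a set \<Rightarrow> ('a set \<Rightarrow> 'a set) \<Rightarrow> 'a set set" where
  "reverse_Cech X c = {\<sigma>. \<sigma> \<noteq> {} \<and> finite \<sigma> \<and> \<sigma> \<subseteq> X \<and> (\<exists>x\<in>X. \<forall>y\<in>\<sigma>. x \<in> c {y})}"

definition star_closure :: "'a set set \<Rightarrow> 'a set \<Rightarrow> 'a set" where
  "star_closure E A = \<Union>{\<sigma> \<in> E. \<sigma> \<inter> A \<noteq> {}}"

end

theory Submission
  imports Defs
begin

text \<open>The only neighborhood of a point of \<open>Jtop\<close> is \<open>Jtop\<close> itself, so the product closure on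
  \<open>X \<times> Jtop\<close> only sees first coordinates: \<open>(x, t)\<close> lies in the closure of \<open>A\<close> iff \<open>x\<close> lies in the
  closure of the projection of \<open>A\<close>. Hence a one-step homotopy from \<open>f\<close> to \<open>g\<close> implies that,
  whenever \<open>y \<in> c x\<close>, both \<open>f y\<close> and \<open>g y\<close> lie in both \<open>c (f x)\<close> and \<open>c (g x)\<close>, and the simplices
  in question are defined by such relations. Conversely, a simplex through \<open>x\<close> and \<open>y\<close> is sent by
  \<open>f\<close> and \<open>g\<close> together into a single simplex.\<close>

section \<open>Closure operators and continuity\<close>

lemma closure_space_Un:
  "closure_space X c \<Longrightarrow> A \<subseteq> X \<Longrightarrow> B \<subseteq> X \<Longrightarrow> c (A \<union> B) = c A \<union> c B"
  by (simp add: closure_space_def)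

lemma closure_space_extensive: "closure_space X c \<Longrightarrow> A \<subseteq> X \<Longrightarrow> A \<subseteq> c A"
  by (simp add: closure_space_def)

lemma closure_space_subset: "closure_space X c \<Longrightarrow> A \<subseteq> X \<Longrightarrow> c A \<subseteq> X"
  by (simp add: closure_space_def)

text \<open>Monotonicity comes from additivity: \<open>A \<union> B = B\<close> turns
  \<open>c B\<close> into \<open>c A \<union> c B\<close>.\<close>

lemma closure_space_mono:
  assumes "closure_space X c" "A \<subseteq> B" "B \<subseteq> X"
  shows "c A \<subseteq> c B"
proof -
  have "A \<subseteq> X" using assms by blast
  then have "c (A \<union> B) = c A \<union> c B" using assms(1,3) by (intro closure_space_Un)
  moreover have "A \<union> B = B" using assms(2) by blast
  ultimately show ?thesis by auto
qed

lemma closure_continuous_image_subset: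
  "closure_continuous X cX Y cY f \<Longrightarrow> A \<subseteq> X \<Longrightarrow> f ` cX A \<subseteq> cY (f ` A)"
  by (simp add: closure_continuous_def)

section \<open>The product with \<open>Jtop\<close> and homotopies on it\<close>

lemma closure_nhd_Jtop_iff:
  "t \<in> Jtop \<Longrightarrow> closure_nhd Jtop Jtop_closure t V \<longleftrightarrow> V = Jtop"
  by (auto simp: closure_nhd_def Jtop_closure_def)

lemma mem_product_closure_Jtop_iff:
  assumes c: "closure_space X c" and A: "A \<subseteq> X \<times> Jtop"
  shows "(x, t) \<in> product_closure X c Jtop Jtop_closure A \<longleftrightarrow> t \<in> Jtop \<and> x \<in> c (fst ` A)"
proof
  assume L: "(x, t) \<in> product_closure X c Jtop Jtop_closure A"
  then have t: "t \<in> Jtop" by (auto simp: product_closure_def)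
  have "x \<in> c (fst ` A)"
  proof (rule ccontr)
    assume "x \<notin> c (fst ` A)"
    \<comment> \<open>The complement of the projection of \<open>A\<close> would be a neighborhood
      of \<open>x\<close>, and its product with \<open>Jtop\<close> misses \<open>A\<close>.\<close>
    moreover have "X - (X - fst ` A) = fst ` A" using A by auto
    ultimately have "closure_nhd X c x (X - fst ` A)" by (simp add: closure_nhd_def)
    moreover have "closure_nhd Jtop Jtop_closure t Jtop" using t by (simp add: closure_nhd_Jtop_iff)
    ultimately have "(X - fst ` A) \<times> Jtop \<inter> A \<noteq> {}"
      using L unfolding product_closure_def by blast
    then show False by force
  qed
  with t show "t \<in> Jtop \<and> x \<in> c (fst ` A)" by blast
next
  assume R: "t \<in> Jtop \<and> x \<in> c (fst ` A)"
  have fA: "fst ` A \<subseteq> X" using A by auto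
  have "x \<in> X" using R closure_space_subset[OF c fA] by blast
  moreover have "U \<times> V \<inter> A \<noteq> {}"
    if U: "closure_nhd X c x U" and V: "closure_nhd Jtop Jtop_closure t V" for U V
  proof -
    \<comment> \<open>If the projection of \<open>A\<close> missed \<open>U\<close>, monotonicity
      would put \<open>x\<close> into \<open>c (X - U)\<close>, which a neighborhood
      forbids.\<close>
    have "\<not> fst ` A \<subseteq> X - U"
      using closure_space_mono[OF c, of "fst ` A" "X - U"] R U unfolding closure_nhd_def by blast
    then obtain a where "a \<in> A" "fst a \<in> U" using fA by blast
    moreover have "V = Jtop" using V R by (simp add: closure_nhd_Jtop_iff)
    ultimately have "a \<in> U \<times> V \<inter> A" using A by (auto simp: mem_Times_iff)
    then show ?thesis by blast
  qed
  ultimately show "(x, t) \<in> product_closure X c Jtop Jtop_closure A"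
    using R by (auto simp: product_closure_def)
qed

lemma product_closure_Jtop_eq:
  assumes "closure_space X c" "A \<subseteq> X \<times> Jtop"
  shows "product_closure X c Jtop Jtop_closure A = c (fst ` A) \<times> Jtop"
  using mem_product_closure_Jtop_iff[OF assms] by auto

text \<open>Continuity of a homotopy includes that its domain is a closure space. The axioms
  transfer from \<open>c\<close> because taking the projection commutes with unions.\<close>

lemma closure_space_product_Jtop:
  assumes c: "closure_space X c"
  shows "closure_space (X \<times> Jtop) (product_closure X c Jtop Jtop_closure)"
proof -
  have "product_closure X c Jtop Jtop_closure {} = {}"
    using c by (simp add: product_closure_Jtop_eq closure_space_def)
  moreover have "A \<subseteq> product_closure X c Jtop Jtop_closure A \<and>
      product_closure X c Jtop Jtop_closure A \<subseteq> X \<times> Jtop" if A: "A \<subseteq> X \<times> Jtop" for A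
  proof -
    have "fst ` A \<subseteq> X" using A by auto
    then have "fst ` A \<subseteq> c (fst ` A)" "c (fst ` A) \<subseteq> X"
      using closure_space_extensive[OF c] closure_space_subset[OF c] by simp_all
    then show ?thesis using A by (force simp: product_closure_Jtop_eq[OF c A])
  qed
  moreover have "product_closure X c Jtop Jtop_closure (A \<union> B) =
      product_closure X c Jtop Jtop_closure A \<union> product_closure X c Jtop Jtop_closure B"
    if A: "A \<subseteq> X \<times> Jtop" and B: "B \<subseteq> X \<times> Jtop" for A B
  proof -
    have AB: "A \<union> B \<subseteq> X \<times> Jtop" using A B by blast
    have "fst ` A \<subseteq> X" "fst ` B \<subseteq> X" using A B by auto
    then have "c (fst ` A \<union> fst ` B) = c (fst ` A) \<union> c (fst ` B)"
      using closure_space_Un[OF c] by simp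
    then show ?thesis
      by (simp add: product_closure_Jtop_eq[OF c A] product_closure_Jtop_eq[OF c B]
          product_closure_Jtop_eq[OF c AB] image_Un Sigma_Un_distrib1)
  qed
  ultimately show ?thesis unfolding closure_space_def by simp
qed

text \<open>The product closure of the single point \<open>(x, s)\<close> is
  \<open>cX {x} \<times> Jtop\<close>, so continuity of \<open>H\<close> relates the level
  \<open>s\<close> over \<open>x\<close> to every level \<open>t\<close> over \<open>y\<close>. The
  four claims are the four choices of \<open>s\<close> and \<open>t\<close>.\<close>

lemma one_step_homotopic_point_closure:
  assumes c: "closure_space X cX" and h: "one_step_homotopic X cX Y cY f g"
    and x: "x \<in> X" and y: "y \<in> cX {x}"
  shows "f y \<in> cY {f x}" "g y \<in> cY {f x}" "f y \<in> cY {g x}" "g y \<in> cY {g x}"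
proof -
  obtain H where H: "closure_continuous (X \<times> Jtop) (product_closure X cX Jtop Jtop_closure) Y cY H"
    and ends: "\<forall>x\<in>X. H (x, 0) = f x \<and> H (x, 1) = g x"
    using h unfolding one_step_homotopic_def by blast
  have yX: "y \<in> X" using closure_space_subset[OF c, of "{x}"] x y by blast
  have key: "H (y, t) \<in> cY {H (x, s)}" if "s \<in> Jtop" "t \<in> Jtop" for s t
  proof -
    have sub: "{(x, s)} \<subseteq> X \<times> Jtop" using x that by blast
    then have "(y, t) \<in> product_closure X cX Jtop Jtop_closure {(x, s)}"
      using y that by (simp add: product_closure_Jtop_eq[OF c])
    moreover have "H ` product_closure X cX Jtop Jtop_closure {(x, s)} \<subseteq> cY (H ` {(x, s)})"
      by (rule closure_continuous_image_subset[OF H sub])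
    ultimately show ?thesis by auto
  qed
  show "f y \<in> cY {f x}" "g y \<in> cY {f x}" "f y \<in> cY {g x}" "g y \<in> cY {g x}"
    using key[of 0 0] key[of 0 1] key[of 1 0] key[of 1 1] ends x yX by (auto simp: Jtop_def)
qed

section \<open>The three complexes of a closure space, and contiguity from a homotopy\<close>

lemma simplicial_complexI:
  assumes "\<And>\<sigma>. \<sigma> \<in> E \<Longrightarrow> \<sigma> \<noteq> {}" "\<And>\<sigma>. \<sigma> \<in> E \<Longrightarrow> finite \<sigma>" "\<And>\<sigma>. \<sigma> \<in> E \<Longrightarrow> \<sigma> \<subseteq> X"
    and "\<And>x. x \<in> X \<Longrightarrow> {x} \<in> E"
    and "\<And>\<sigma> \<tau>. \<sigma> \<in> E \<Longrightarrow> \<tau> \<subseteq> \<sigma> \<Longrightarrow> \<tau> \<noteq> {} \<Longrightarrow> \<tau> \<in> E"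
  shows "simplicial_complex X E"
  unfolding simplicial_complex_def by (intro conjI ballI allI impI; rule assms; assumption)

lemma simplicial_complex_VR:
  assumes "closure_space X c"
  shows "simplicial_complex X (VR X c)"
proof (rule simplicial_complexI)
  show "{x} \<in> VR X c" if "x \<in> X" for x
    using closure_space_extensive[OF assms, of "{x}"] that by (auto simp: VR_def)
  show "\<tau> \<in> VR X c" if "\<sigma> \<in> VR X c" "\<tau> \<subseteq> \<sigma>" "\<tau> \<noteq> {}" for \<sigma> \<tau>
    using that finite_subset[of \<tau> \<sigma>] unfolding VR_def by blast
qed (simp_all add: VR_def)

lemma simplicial_complex_Cech:
  assumes "closure_space X c"
  shows "simplicial_complex X (Cech X c)"
proof (rule simplicial_complexI)
  show "{x} \<in> Cech X c" if "x \<in> X" for x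
    using closure_space_extensive[OF assms, of "{x}"] that by (auto simp: Cech_def)
  show "\<tau> \<in> Cech X c" if "\<sigma> \<in> Cech X c" "\<tau> \<subseteq> \<sigma>" "\<tau> \<noteq> {}" for \<sigma> \<tau>
    using that finite_subset[of \<tau> \<sigma>] unfolding Cech_def by blast
qed (simp_all add: Cech_def)

lemma simplicial_complex_reverse_Cech:
  assumes "closure_space X c"
  shows "simplicial_complex X (reverse_Cech X c)"
proof (rule simplicial_complexI)
  show "{x} \<in> reverse_Cech X c" if "x \<in> X" for x
    using closure_space_extensive[OF assms, of "{x}"] that by (auto simp: reverse_Cech_def)
  show "\<tau> \<in> reverse_Cech X c" if "\<sigma> \<in> reverse_Cech X c" "\<tau> \<subseteq> \<sigma>" "\<tau> \<noteq> {}" for \<sigma> \<tau>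
    using that finite_subset[of \<tau> \<sigma>] unfolding reverse_Cech_def by blast
qed (simp_all add: reverse_Cech_def)

text \<open>The images under \<open>f\<close> and \<open>g\<close> are nonempty subsets of a simplex
  of \<open>F\<close>, hence simplices themselves. So the condition on unions already makes both
  maps simplicial.\<close>

lemma contiguousI:
  assumes E: "simplicial_complex X E" and F: "simplicial_complex Y F"
    and "f ` X \<subseteq> Y" "g ` X \<subseteq> Y"
    and un: "\<And>\<sigma>. \<sigma> \<in> E \<Longrightarrow> f ` \<sigma> \<union> g ` \<sigma> \<in> F"
  shows "contiguous X E Y F f g"
proof -
  have "f ` \<sigma> \<in> F \<and> g ` \<sigma> \<in> F" if \<sigma>: "\<sigma> \<in> E" for \<sigma>
  proof -
    have "\<sigma> \<noteq> {}" using E \<sigma> unfolding simplicial_complex_def by blast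
    then have "f ` \<sigma> \<noteq> {}" "g ` \<sigma> \<noteq> {}" by auto
    then show ?thesis using F un[OF \<sigma>] unfolding simplicial_complex_def by (meson Un_upper1 Un_upper2)
  qed
  then show ?thesis using assms unfolding contiguous_def simplicial_map_def by blast
qed

lemma one_step_homotopic_contiguous:
  assumes cX: "closure_space X cX" and cY: "closure_space Y cY"
    and h: "one_step_homotopic X cX Y cY f g"
  shows "contiguous X (VR X cX) Y (VR Y cY) f g"
    and "contiguous X (Cech X cX) Y (Cech Y cY) f g"
    and "contiguous X (reverse_Cech X cX) Y (reverse_Cech Y cY) f g"
proof -
  note pc = one_step_homotopic_point_closure[OF cX h]
  have f: "f ` X \<subseteq> Y" and g: "g ` X \<subseteq> Y"
    using h unfolding one_step_homotopic_def closure_continuous_def by auto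
  show "contiguous X (VR X cX) Y (VR Y cY) f g"
  proof (rule contiguousI)
    fix \<sigma> assume "\<sigma> \<in> VR X cX"
    then have \<sigma>: "\<sigma> \<noteq> {}" "finite \<sigma>" "\<sigma> \<subseteq> X" "\<And>x. x \<in> \<sigma> \<Longrightarrow> \<sigma> \<subseteq> cX {x}"
      by (auto simp: VR_def)
    \<comment> \<open>Every vertex of the union is \<open>f x\<close> or \<open>g x\<close> for some
      \<open>x\<close> in \<open>\<sigma>\<close>, so these two inclusions cover all vertices; they
      use all four point relations.\<close>
    have "f ` \<sigma> \<union> g ` \<sigma> \<subseteq> cY {f x}" "f ` \<sigma> \<union> g ` \<sigma> \<subseteq> cY {g x}" if "x \<in> \<sigma>" for x
    proof -
      have "x \<in> X" using \<sigma>(3) that by blast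
      with pc[of x] \<sigma>(4)[OF that]
      show "f ` \<sigma> \<union> g ` \<sigma> \<subseteq> cY {f x}" "f ` \<sigma> \<union> g ` \<sigma> \<subseteq> cY {g x}" by auto
    qed
    then have "\<forall>z \<in> f ` \<sigma> \<union> g ` \<sigma>. f ` \<sigma> \<union> g ` \<sigma> \<subseteq> cY {z}" by blast
    moreover have "f ` \<sigma> \<union> g ` \<sigma> \<subseteq> Y" using \<sigma>(3) f g by blast
    ultimately show "f ` \<sigma> \<union> g ` \<sigma> \<in> VR Y cY"
      using \<sigma>(1,2) unfolding VR_def by simp
  qed (use f g cX cY simplicial_complex_VR in auto)
  show "contiguous X (Cech X cX) Y (Cech Y cY) f g"
  proof (rule contiguousI)
    fix \<sigma> assume "\<sigma> \<in> Cech X cX"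
    then obtain x where \<sigma>: "\<sigma> \<noteq> {}" "finite \<sigma>" "\<sigma> \<subseteq> X" and x: "x \<in> X" "\<sigma> \<subseteq> cX {x}"
      by (auto simp: Cech_def)
    \<comment> \<open>The image \<open>f x\<close> of the old center serves as center for both
      images at once.\<close>
    have "f ` \<sigma> \<union> g ` \<sigma> \<subseteq> cY {f x}" using pc[of x] x by auto
    moreover have "f ` \<sigma> \<union> g ` \<sigma> \<subseteq> Y" "f x \<in> Y" using \<sigma>(3) x(1) f g by blast+
    ultimately show "f ` \<sigma> \<union> g ` \<sigma> \<in> Cech Y cY"
      using \<sigma>(1,2) unfolding Cech_def by auto
  qed (use f g cX cY simplicial_complex_Cech in auto)
  show "contiguous X (reverse_Cech X cX) Y (reverse_Cech Y cY) f g"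
  proof (rule contiguousI)
    fix \<sigma> assume "\<sigma> \<in> reverse_Cech X cX"
    then obtain x where \<sigma>: "\<sigma> \<noteq> {}" "finite \<sigma>" "\<sigma> \<subseteq> X"
      and x: "x \<in> X" "\<And>y. y \<in> \<sigma> \<Longrightarrow> x \<in> cX {y}"
      by (auto simp: reverse_Cech_def)
    \<comment> \<open>The roles are swapped here: \<open>x\<close> lies in the closure of each
      vertex \<open>y\<close>, so \<open>f x\<close> is the common point for the vertices of both
      images.\<close>
    have "f x \<in> cY {f y} \<and> f x \<in> cY {g y}" if "y \<in> \<sigma>" for y
      using pc[of y x] x(2)[OF that] that \<sigma>(3) by auto
    then have "\<forall>y \<in> f ` \<sigma> \<union> g ` \<sigma>. f x \<in> cY {y}" by auto
    moreover have "f ` \<sigma> \<union> g ` \<sigma> \<subseteq> Y" "f x \<in> Y" using \<sigma>(3) x(1) f g by blast+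
    ultimately show "f ` \<sigma> \<union> g ` \<sigma> \<in> reverse_Cech Y cY"
      using \<sigma>(1,2) unfolding reverse_Cech_def by auto
  qed (use f g cX cY simplicial_complex_reverse_Cech in auto)
qed

section \<open>Star closures, and a homotopy from contiguity\<close>

lemma mem_star_closure_iff:
  "x \<in> star_closure E A \<longleftrightarrow> (\<exists>\<sigma>\<in>E. x \<in> \<sigma> \<and> (\<exists>a\<in>A. a \<in> \<sigma>))"
  by (auto simp: star_closure_def)

text \<open>Singleton simplices give extensivity, and additivity holds because a simplex meets a
  union iff it meets one of the two sets.\<close>

lemma closure_space_star_closure:
  assumes "simplicial_complex X E"
  shows "closure_space X (star_closure E)"
proof -
  have sub: "\<And>\<sigma>. \<sigma> \<in> E \<Longrightarrow> \<sigma> \<subseteq> X" and single: "\<And>x. x \<in> X \<Longrightarrow> {x} \<in> E"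
    using assms by (simp_all add: simplicial_complex_def)
  have "A \<subseteq> star_closure E A" if "A \<subseteq> X" for A
  proof
    fix x assume "x \<in> A"
    then show "x \<in> star_closure E A"
      using single[of x] that unfolding mem_star_closure_iff by blast
  qed
  moreover have "star_closure E A \<subseteq> X" for A
    using sub unfolding star_closure_def by blast
  moreover have "star_closure E {} = {}"
    by (simp add: star_closure_def)
  moreover have "star_closure E (A \<union> B) = star_closure E A \<union> star_closure E B" for A B
    unfolding star_closure_def by blast
  ultimately show ?thesis by (simp add: closure_space_def)
qed

text \<open>A simplex joining \<open>x\<close> to a point of \<open>A\<close> is mapped to a simplex
  joining \<open>f x\<close> to a point of the image of \<open>A\<close>.\<close>

lemma closure_continuous_star_closure:
  assumes f: "simplicial_map X E Y F f"
  shows "closure_continuous X (star_closure E) Y (star_closure F) f"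
proof -
  have "f x \<in> star_closure F (f ` A)" if x: "x \<in> star_closure E A" for A x
  proof -
    obtain \<sigma> a where "\<sigma> \<in> E" "x \<in> \<sigma>" "a \<in> A" "a \<in> \<sigma>"
      using x by (auto simp: mem_star_closure_iff)
    moreover from this have "f ` \<sigma> \<in> F" using f by (simp add: simplicial_map_def)
    ultimately show ?thesis unfolding mem_star_closure_iff by blast
  qed
  then show ?thesis
    using f unfolding closure_continuous_def simplicial_map_def
    by (simp add: closure_space_star_closure image_subset_iff)
qed

lemma contiguous_one_step_homotopic:
  assumes "contiguous X E Y F f g"
  shows "one_step_homotopic X (star_closure E) Y (star_closure F) f g"
proof -
  have f: "simplicial_map X E Y F f" and g: "simplicial_map X E Y F g"
    and un: "\<And>\<sigma>. \<sigma> \<in> E \<Longrightarrow> f ` \<sigma> \<union> g ` \<sigma> \<in> F"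
    using assms unfolding contiguous_def by auto
  \<comment> \<open>Level 0 carries \<open>f\<close> and every other level carries \<open>g\<close>;
    only the levels 0 and 1 lie in \<open>Jtop\<close>.\<close>
  define H :: "'a \<times> nat \<Rightarrow> 'b" where "H p = (if snd p = 0 then f (fst p) else g (fst p))" for p
  have E: "closure_space X (star_closure E)" and F: "closure_space Y (star_closure F)"
    using f by (simp_all add: simplicial_map_def closure_space_star_closure)
  have "H p \<in> star_closure F (H ` A)"
    if A: "A \<subseteq> X \<times> Jtop" and p: "p \<in> product_closure X (star_closure E) Jtop Jtop_closure A"
    for A p
  proof -
    have "fst p \<in> star_closure E (fst ` A)"
      using p by (auto simp: product_closure_Jtop_eq[OF E A])
    then obtain \<sigma> a where \<sigma>: "\<sigma> \<in> E" and "fst p \<in> \<sigma>" "a \<in> A" "fst a \<in> \<sigma>"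
      by (auto simp: mem_star_closure_iff)
    \<comment> \<open>The points \<open>p\<close> and \<open>a\<close> may lie on different levels,
      so one value may come from \<open>f\<close> and the other from \<open>g\<close>. Contiguity
      makes the union of both images a single simplex, which contains \<open>H p\<close> and
      \<open>H a\<close> in every case.\<close>
    moreover from this have "H p \<in> f ` \<sigma> \<union> g ` \<sigma>" "H a \<in> f ` \<sigma> \<union> g ` \<sigma>"
      by (auto simp: H_def)
    ultimately show ?thesis
      unfolding mem_star_closure_iff by (intro bexI[OF _ un[OF \<sigma>]] conjI bexI[OF _ imageI])
  qed
  moreover have "H ` (X \<times> Jtop) \<subseteq> Y"
  proof -
    have "f ` X \<subseteq> Y" "g ` X \<subseteq> Y" using f g by (simp_all add: simplicial_map_def)
    then show ?thesis by (auto simp: H_def)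
  qed
  ultimately have "closure_continuous (X \<times> Jtop)
      (product_closure X (star_closure E) Jtop Jtop_closure) Y (star_closure F) H"
    using closure_space_product_Jtop[OF E] F by (simp add: closure_continuous_def image_subset_iff)
  moreover have "\<forall>x\<in>X. H (x, 0) = f x \<and> H (x, 1) = g x" by (simp add: H_def)
  ultimately show ?thesis
    using closure_continuous_star_closure[OF f] closure_continuous_star_closure[OF g]
    unfolding one_step_homotopic_def by blast
qed

theorem theorem6p17:
  shows "(\<forall>(X :: 'a set) cX (Y :: 'b set) cY f g.
            closure_space X cX \<and> closure_space Y cY \<and> one_step_homotopic X cX Y cY f g \<longrightarrow>
              contiguous X (VR X cX) Y (VR Y cY) f g \<and>
              contiguous X (Cech X cX) Y (Cech Y cY) f g \<and>
              contiguous X (reverse_Cech X cX) Y (reverse_Cech Y cY) f g) \<and>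
         (\<forall>(X :: 'a set) E (Y :: 'b set) F f g.
            simplicial_complex X E \<and> simplicial_complex Y F \<and> contiguous X E Y F f g \<longrightarrow>
              one_step_homotopic X (star_closure E) Y (star_closure F) f g)"
  by (intro conjI allI impI; elim conjE)
    (simp_all add: one_step_homotopic_contiguous contiguous_one_step_homotopic)

end
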